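(* (Time complexity of the parallel protocol.) The time complexity of the $(n,k)$-QRAM, executed with the parallel protocol, is $O(n+k)$ in both the qutrit-based scheme and the qubit-based scheme, where $n$ is the address size and $k$ is the data size (word length).
   Context: **$(n,k)$-QRAM.** A device acting on an address bus $A$ of $n$ qubits and a data bus $D$ of $k$ qubits, storing $2^n$ classical $k$-bit entries $x_i$ ($0\le i\le 2^n-1$), and intended to implement $U_{\mathrm{QRAM}}|i\rangle_A|d\rangle_D=|i\rangle_A|d\oplus x_i\rangle_D$. **Structure (bucket-brigade).** A full binary tree of $n$ layers $0,\dots,n-1$. Nodes are $(l,p)$, $0\le p\le 2^l-1$, and the children of $(l,p)$ are $(l+1,2p)$ (left) and $(l+1,2p+1)$ (right). Each node has an address qudit and one data qubit. In the qutrit-based scheme the address qudit is a qutrit with levels $|L\rangle$ (left), $|R\rangle$ (right), $|W\rangle$ (wait, i.e. inactive). In the qubit-based scheme it is a qubit with $|0\rangle$ for left and $|1\rangle$ for right. The classical memory is attached below the last layer. **Fundamental operations** (each counts as one time step; routing, internal swap and data copy are layered, i.e. applied simultaneously to all nodes of a layer). - Routing $R_l$: for each node of layer $l$, swap its data qubit with the data qubit of the left or right child according to its address qudit (nothing if $|W\rangle$). When only moving data from parent to child it is written $R_l^{\downarrow}$, from child to parent $R_l^{\uparrow}$, and in both directions at once $R_l^{\updownarrow}$. - Internal swap $I_l$: in each node of layer $l$, transfer the state of the data qubit to the address qudit. In the qubit-based scheme this is a SWAP. In the qutrit-based scheme it maps $|W,0\rangle\mapsto|L,0\rangle$, $|W,1\rangle\mapsto|R,0\rangle$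 and is conditioned on the parent's address qutrit being active and pointing to the node. - Address bus input $A(i)$: CNOT copying the $i$-th address-bus digit to the root's data qubit. - Data bus input $D(i)$: SWAP moving the $i$-th data-bus digit to the root's data qubit (and, at the end of its route, back to the bus). In the qubit-based scheme a Hadamard gate is also used so that the bit is encoded in the $\{|+\rangle,|-\rangle\}$ basis inside the tree. - Data copy $M(i)$: at the last layer, a classically controlled operation writing the $i$-th bit of the memory entry selected by a node's address qudit into its data qubit, by a classically controlled CNOT (qutrit-based) or a classically controlled CZ, i.e. a phase flip (qubit-based). **Parallel protocol.** It has three phases. 1. Address setting: for each address digit $i=0,\dots,n-1$ the sequence $A(i),R_0,R_1,\dots,R_{i-1},I_i$ is to be performed. Operations that commute because they act on different layers are advanced as early as possible, so that a digit enters the tree before its predecessors have reached their layers. 2. Data fetch: for each data digit $i=0,\dots,k-1$ the sequence is $D(i)$, then routings $R_0^{\downarrow},R_1^{\downarrow},\dots$ layer by layer from the root to the bottom, then $M(i)$, then the routings $\dots,R_1^{\uparrow},R_0^{\uparrow}$ back to the root, then $D(i)$. Each digit's sequence starts two time steps after that of the previous digit, and the sequences run concurrently. When $R_l^{\uparrow}$ and $R_l^{\downarrow}$ fall in the same time step, they are replaced by the single operation $R_l^{\updownarrow}$. 3. Uncomputing: the reverse of the address setting phase. The time complexity is the total number of time steps. *)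

theory Defs
  imports Complex_Main "HOL-Library.Landau_Symbols"
begin

datatype scheme = Qutrit_Based | Qubit_Based

text \<open>
  The qudits of the device: the digits of the two buses, and the address qudit and the data qubit
  of the tree node \<open>(l, p)\<close>.  One type of levels serves all of them: for address qudits, \<open>Zero\<close> is
  left and \<open>One\<close> is right.  \<open>Wait\<close> is meant for the address qutrits of the qutrit-based scheme
  only; no gate below brings it onto a qudit that is meant to be a qubit.
\<close>

datatype qudit =
    Address_Bus nat
  | Data_Bus nat
  | Addr nat nat
  | Data nat nat

datatype level = Zero | One | Wait

type_synonym basis_state = "qudit \<Rightarrow> level"
type_synonym state = "basis_state \<Rightarrow> complex"
type_synonym gate = "state \<Rightarrow> state"

text \<open>\<open>x i j\<close> is the \<open>j\<close>-th bit of the memory entry \<open>i\<close>.\<close>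

type_synonym memory = "nat \<Rightarrow> nat \<Rightarrow> bool"


section \<open>Gates\<close>

text \<open>
  The gate that sends the basis vector of \<open>b\<close> to that of \<open>f b\<close>.  This reading of the formula needs
  \<open>f\<close> to be an involution, which is the case for all the maps used below.
\<close>

definition permute :: "(basis_state \<Rightarrow> basis_state) \<Rightarrow> gate" where
  "permute f \<psi> = \<psi> \<circ> f"

definition hadamard :: "qudit \<Rightarrow> gate" where
  "hadamard q \<psi> b = (case b q of
       Zero \<Rightarrow> (\<psi> (b(q := Zero)) + \<psi> (b(q := One))) / complex_of_real (sqrt 2)
     | One \<Rightarrow> (\<psi> (b(q := Zero)) - \<psi> (b(q := One))) / complex_of_real (sqrt 2)
     | Wait \<Rightarrow> \<psi> b)"

definition phase_flip :: "(basis_state \<Rightarrow> bool) \<Rightarrow> gate" where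
  "phase_flip P \<psi> b = (if P b then - \<psi> b else \<psi> b)"

definition exchange :: "qudit \<Rightarrow> qudit \<Rightarrow> basis_state \<Rightarrow> basis_state" where
  "exchange q r b = b(q := b r, r := b q)"

fun negate :: "level \<Rightarrow> level" where
  "negate Zero = One"
| "negate One = Zero"
| "negate Wait = Wait"

definition flip_if :: "(basis_state \<Rightarrow> bool) \<Rightarrow> qudit \<Rightarrow> basis_state \<Rightarrow> basis_state" where
  "flip_if P q b = (if P b then b(q := negate (b q)) else b)"

definition on_layer :: "nat \<Rightarrow> (nat \<Rightarrow> gate) \<Rightarrow> gate" where
  "on_layer l g = fold g [0..<2 ^ l]"

definition route_node :: "nat \<Rightarrow> nat \<Rightarrow> basis_state \<Rightarrow> basis_state" where
  "route_node l p b = (case b (Addr l p) of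
       Zero \<Rightarrow> exchange (Data l p) (Data (Suc l) (2 * p)) b
     | One \<Rightarrow> exchange (Data l p) (Data (Suc l) (2 * p + 1)) b
     | Wait \<Rightarrow> b)"

definition pointed_at :: "nat \<Rightarrow> nat \<Rightarrow> basis_state \<Rightarrow> bool" where
  "pointed_at l p b \<longleftrightarrow>
     l = 0 \<or> b (Addr (l - 1) (p div 2)) = (if even p then Zero else One)"

text \<open>
  The internal swap of the qutrit-based scheme is prescribed on \<open>|W,0\<rangle>\<close> and \<open>|W,1\<rangle>\<close> only; it is
  completed to an involution, so that it also undoes itself.
\<close>

definition store_node :: "nat \<Rightarrow> nat \<Rightarrow> basis_state \<Rightarrow> basis_state" where
  "store_node l p b =
     (if pointed_at l p b then
        (case (b (Addr l p), b (Data l p)) of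
           (Wait, Zero) \<Rightarrow> b(Addr l p := Zero, Data l p := Zero)
         | (Wait, One) \<Rightarrow> b(Addr l p := One, Data l p := Zero)
         | (Zero, Zero) \<Rightarrow> b(Addr l p := Wait, Data l p := Zero)
         | (One, Zero) \<Rightarrow> b(Addr l p := Wait, Data l p := One)
         | _ \<Rightarrow> b)
      else b)"

text \<open>
  Node \<open>p\<close> of the last layer is attached to the memory entries \<open>2 * p\<close> and \<open>2 * p + 1\<close>; a waiting
  node selects none.
\<close>

definition selected_bit :: "nat \<Rightarrow> memory \<Rightarrow> nat \<Rightarrow> nat \<Rightarrow> basis_state \<Rightarrow> bool" where
  "selected_bit n x i p b = (case b (Addr (n - 1) p) of
       Zero \<Rightarrow> x (2 * p) i
     | One \<Rightarrow> x (2 * p + 1) i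
     | Wait \<Rightarrow> False)"

lemma exchange_involution: "exchange q r (exchange q r b) = b"
  by (auto simp: exchange_def)

lemma negate_negate: "negate (negate v) = v"
  by (cases v) auto

lemma flip_if_involution:
  assumes "\<And>v. P (b(q := v)) = P b"
  shows "flip_if P q (flip_if P q b) = b"
  using assms by (auto simp: flip_if_def negate_negate)

lemma route_node_involution: "route_node l p (route_node l p b) = b"
  by (auto simp: route_node_def exchange_def split: level.splits)

lemma store_node_involution: "store_node l p (store_node l p b) = b"
  by (cases "b (Addr l p)"; cases "b (Data l p)")
     (auto simp: store_node_def pointed_at_def fun_upd_idem_iff)


section \<open>Fundamental operations\<close>

datatype direction = Down | Up | Both

text \<open>
  The direction of a routing records which data it is meant to move; the gate is the same.  The two
  uses of \<open>D(i)\<close> are kept apart because in the qubit-based scheme the Hadamard gate acts on the bus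
  digit before the swap into the tree and after the swap out of it.
\<close>

datatype operation =
    Address_Input nat
  | Route direction nat
  | Internal_Swap nat
  | Data_Input nat
  | Data_Output nat
  | Data_Copy nat

fun gate_of :: "scheme \<Rightarrow> nat \<Rightarrow> memory \<Rightarrow> operation \<Rightarrow> gate" where
  "gate_of s n x (Address_Input i) =
     permute (flip_if (\<lambda>b. b (Address_Bus i) = One) (Data 0 0))"
| "gate_of s n x (Route d l) = on_layer l (\<lambda>p. permute (route_node l p))"
| "gate_of s n x (Internal_Swap l) = on_layer l (\<lambda>p. permute (case s of
       Qutrit_Based \<Rightarrow> store_node l p
     | Qubit_Based \<Rightarrow> exchange (Data l p) (Addr l p)))"
| "gate_of s n x (Data_Input i) = (case s of
       Qutrit_Based \<Rightarrow> permute (exchange (Data_Bus i) (Data 0 0))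
     | Qubit_Based \<Rightarrow> permute (exchange (Data_Bus i) (Data 0 0)) \<circ> hadamard (Data_Bus i))"
| "gate_of s n x (Data_Output i) = (case s of
       Qutrit_Based \<Rightarrow> permute (exchange (Data_Bus i) (Data 0 0))
     | Qubit_Based \<Rightarrow> hadamard (Data_Bus i) \<circ> permute (exchange (Data_Bus i) (Data 0 0)))"
| "gate_of s n x (Data_Copy i) = on_layer (n - 1) (\<lambda>p. case s of
       Qutrit_Based \<Rightarrow> permute (flip_if (selected_bit n x i p) (Data (n - 1) p))
     | Qubit_Based \<Rightarrow> phase_flip (\<lambda>b. selected_bit n x i p b \<and> b (Data (n - 1) p) = One))"

text \<open>
  \<open>acts_within S U\<close>: the gate \<open>U\<close> is of the form \<open>V \<otimes> id\<close> with \<open>V\<close> acting on the qudits in \<open>S\<close>.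
  For each basis assignment of the other qudits, the corresponding slice of \<open>U \<psi>\<close> is a
  function of the same slice of \<open>\<psi>\<close>, and that function does not depend on the assignment.
\<close>

definition acts_within :: "qudit set \<Rightarrow> gate \<Rightarrow> bool" where
  "acts_within S U \<longleftrightarrow> (\<forall>\<psi> \<phi> b c.
     (\<forall>a. \<psi> (override_on b a S) = \<phi> (override_on c a S)) \<longrightarrow>
     (\<forall>a. U \<psi> (override_on b a S) = U \<phi> (override_on c a S)))"

text \<open>The memory is quantified inside, since the schedule must not depend on its contents.\<close>

definition independent :: "scheme \<Rightarrow> nat \<Rightarrow> operation \<Rightarrow> operation \<Rightarrow> bool" where
  "independent s n g h \<longleftrightarrow> (\<exists>S T. S \<inter> T = {} \<and>
     (\<forall>x. acts_within S (gate_of s n x g) \<and> acts_within T (gate_of s n x h)))"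


section \<open>The parallel protocol\<close>

text \<open>A schedule is a set of pairs of a starting time and an operation.\<close>

definition time_steps :: "(nat \<times> operation) set \<Rightarrow> operation set list" where
  "time_steps E = map (\<lambda>t. {g. (t, g) \<in> E}) [0..<Max (insert 0 ((Suc \<circ> fst) ` E))]"

text \<open>
  Advancing an operation past all earlier ones that act on other qudits: it is performed right
  after the last earlier operation that it depends on.
\<close>

definition advance ::
  "scheme \<Rightarrow> nat \<Rightarrow> (nat \<times> operation) set \<Rightarrow> operation \<Rightarrow> (nat \<times> operation) set" where
  "advance s n E g =
     insert (Max (insert 0 {Suc t | t h. (t, h) \<in> E \<and> \<not> independent s n h g}), g) E"

definition as_early_as_possible ::
  "scheme \<Rightarrow> nat \<Rightarrow> operation list \<Rightarrow> (nat \<times> operation) set" where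
  "as_early_as_possible s n gs = foldl (advance s n) {} gs"

definition address_sequence :: "nat \<Rightarrow> operation list" where
  "address_sequence i = Address_Input i # map (Route Down) [0..<i] @ [Internal_Swap i]"

definition address_setting :: "scheme \<Rightarrow> nat \<Rightarrow> operation set list" where
  "address_setting s n =
     time_steps (as_early_as_possible s n (concat (map address_sequence [0..<n])))"

text \<open>The last layer is \<open>n - 1\<close>, so \<open>n - 1\<close> routings take a digit from the root to the bottom.\<close>

definition data_sequence :: "nat \<Rightarrow> nat \<Rightarrow> operation list" where
  "data_sequence n i =
     Data_Input i # map (Route Down) [0..<n - 1] @
     Data_Copy i # map (Route Up) (rev [0..<n - 1]) @ [Data_Output i]"

definition merge_routings :: "operation set \<Rightarrow> operation set" where
  "merge_routings X =
     (let B = {l. Route Down l \<in> X \<and> Route Up l \<in> X}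
      in X - Route Down ` B - Route Up ` B \<union> Route Both ` B)"

text \<open>
  For \<open>k > n\<close>, digit \<open>i\<close> leaves the root in the time step in which digit \<open>i + n\<close> enters it, so
  \<open>Data_Output i\<close> and \<open>Data_Input (i + n)\<close>, to be applied in this order, share a time step.
\<close>

definition data_fetch :: "nat \<Rightarrow> nat \<Rightarrow> operation set list" where
  "data_fetch n k = map merge_routings (time_steps
     {(2 * i + j, data_sequence n i ! j) | i j. i < k \<and> j < length (data_sequence n i)})"

text \<open>
  The operations of the address setting phase are their own inverses, so uncomputing performs the
  same time steps in reverse order.
\<close>

definition uncomputing :: "scheme \<Rightarrow> nat \<Rightarrow> operation set list" where
  "uncomputing s n = rev (address_setting s n)"

definition parallel_protocol :: "scheme \<Rightarrow> nat \<Rightarrow> nat \<Rightarrow> operation set list" where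
  "parallel_protocol s n k = address_setting s n @ data_fetch n k @ uncomputing s n"

definition time_complexity :: "scheme \<Rightarrow> nat \<Rightarrow> nat \<Rightarrow> nat" where
  "time_complexity s n k = length (parallel_protocol s n k)"

end

theory Submission
  imports Defs
begin

text \<open>
  Operation \<open>j\<close> of address digit \<open>i\<close> can always be performed by time step \<open>2 * i + j\<close>: the digits
  travel down the tree at distance two.  Indeed, an operation \<open>j'\<close> of an earlier digit can only
  violate this if \<open>j + 2 \<le> j'\<close>.  Then operation \<open>j\<close> acts on data qubits of layers up to \<open>j\<close> and
  address qudits of layers below \<open>j\<close>, whereas operation \<open>j'\<close> acts strictly deeper in the tree, so
  the two are independent.  Hence the address setting takes at most \<open>3 * n\<close> time steps, while the
  data fetch takes at most \<open>2 * n + 2 * k\<close> time steps by its definition.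
\<close>

section \<open>Localised gates\<close>

text \<open>The hypothesis makes \<open>f\<close> neither read nor write outside \<open>S\<close>:
  the surroundings \<open>b\<close> pass through unchanged. Precomposition with \<open>f\<close>
  then only reindexes each slice.\<close>

lemma acts_within_permute:
  assumes "\<And>b a. f (override_on b a S) = override_on b (f a) S"
  shows "acts_within S (permute f)"
  unfolding acts_within_def permute_def using assms by simp

lemma acts_within_fold:
  assumes "\<And>y. y \<in> set ys \<Longrightarrow> acts_within S (g y)"
  shows "acts_within S (fold g ys)"
  using assms
proof (induction ys rule: rev_induct)
  case Nil
  then show ?case by (simp add: acts_within_def)
next
  case (snoc y ys)
  then have "acts_within S (g y)" "acts_within S (fold g ys)"
    by auto
  then show ?case
    unfolding acts_within_def fold_append fold.simps comp_def id_def by meson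
qed

lemma acts_within_on_layer:
  assumes "\<And>p. acts_within S (g p)"
  shows "acts_within S (on_layer l g)"
  unfolding on_layer_def using assms by (rule acts_within_fold)

lemma acts_within_address_input:
  assumes "Address_Bus i \<in> S" "Data 0 0 \<in> S"
  shows "acts_within S (gate_of s n x (Address_Input i))"
  using assms by (auto intro!: acts_within_permute simp: flip_if_def override_on_def)

lemma acts_within_route:
  assumes "\<And>p. Addr l p \<in> S" "\<And>p. Data l p \<in> S" "\<And>p. Data (Suc l) p \<in> S"
  shows "acts_within S (gate_of s n x (Route d l))"
  using assms
  by (auto intro!: acts_within_on_layer acts_within_permute
      simp: route_node_def exchange_def override_on_def split: level.splits)

text \<open>The qutrit-based swap is conditioned on the parents' address qutrits, hence layer
  \<open>l - 1\<close>. At the root this truncates to layer \<open>0\<close>, which lies in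
  \<open>S\<close> anyway.\<close>

lemma acts_within_internal_swap:
  assumes addr: "\<And>p. Addr l p \<in> S" and parent: "\<And>p. Addr (l - 1) p \<in> S"
    and data: "\<And>p. Data l p \<in> S"
  shows "acts_within S (gate_of s n x (Internal_Swap l))"
proof -
  have "store_node l p (override_on b a S) = override_on b (store_node l p a) S" for p b a
  proof -
    have "pointed_at l p (override_on b a S) = pointed_at l p a"
      using parent[of "p div 2"] by (simp add: pointed_at_def override_on_def)
    moreover have "override_on b a S (Addr l p) = a (Addr l p)"
      "override_on b a S (Data l p) = a (Data l p)"
      by (simp_all add: override_on_def addr data)
    ultimately show ?thesis
      unfolding store_node_def
      by (cases "a (Addr l p)"; cases "a (Data l p)")
         (auto simp: fun_eq_iff override_on_def addr data)
  qed
  moreover have "exchange (Data l p) (Addr l p) (override_on b a S)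
      = override_on b (exchange (Data l p) (Addr l p) a) S" for p b a
    by (auto simp: exchange_def override_on_def addr data)
  ultimately show ?thesis
    by (cases s) (auto intro!: acts_within_on_layer acts_within_permute)
qed

section \<open>Greedy schedules\<close>

text \<open>A new operation starts right after its latest dependent predecessor \<open>p\<close>, if
  any, which started by \<open>d p < d q\<close>. Deadlines belong to indices because one operation,
  such as \<open>Route Down 0\<close>, recurs with different deadlines.\<close>

lemma as_early_as_possible_deadline:
  assumes "sorted_wrt (\<lambda>p q. independent s n (f p) (f q) \<or> d p < d q) ps"
  shows "finite (as_early_as_possible s n (map f ps)) \<and>
    (\<forall>(t, g) \<in> as_early_as_possible s n (map f ps). \<exists>p \<in> set ps. g = f p \<and> t \<le> d p)"
  using assms
proof (induction ps rule: rev_induct)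
  case Nil
  then show ?case by (simp add: as_early_as_possible_def)
next
  case (snoc q ps)
  define E where "E = as_early_as_possible s n (map f ps)"
  define B where "B = {Suc t | t h. (t, h) \<in> E \<and> \<not> independent s n h (f q)}"
  have step: "as_early_as_possible s n (map f (ps @ [q])) = insert (Max (insert 0 B), f q) E"
    by (simp add: as_early_as_possible_def advance_def E_def B_def)
  have fin: "finite E" and IH: "\<And>t g. (t, g) \<in> E \<Longrightarrow> \<exists>p \<in> set ps. g = f p \<and> t \<le> d p"
    using snoc by (auto simp: sorted_wrt_append E_def)
  have sep: "\<And>p. p \<in> set ps \<Longrightarrow> independent s n (f p) (f q) \<or> d p < d q"
    using snoc.prems by (simp add: sorted_wrt_append)
  have "B \<subseteq> (Suc \<circ> fst) ` E"
    by (force simp: B_def)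
  then have "finite B"
    using fin finite_surj by blast
  moreover have "u \<le> d q" if "u \<in> B" for u
    using that IH sep unfolding B_def by fastforce
  ultimately have "Max (insert 0 B) \<le> d q"
    by simp
  with fin IH show ?case
    unfolding step by auto
qed

lemma length_time_steps_le:
  assumes "finite E" "\<And>t g. (t, g) \<in> E \<Longrightarrow> t < m"
  shows "length (time_steps E) \<le> m"
  using assms by (force simp: time_steps_def Suc_le_eq)

section \<open>Duration of the phases\<close>

lemma length_address_sequence [simp]: "length (address_sequence i) = i + 2"
  by (simp add: address_sequence_def)

lemma address_sequence_nth:
  assumes "j < i + 2"
  shows "address_sequence i ! j =
    (if j = 0 then Address_Input i
     else if j \<le> i then Route Down (j - 1) else Internal_Swap i)"
  using assms by (auto simp: address_sequence_def nth_Cons nth_append split: nat.splits)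

lemma independent_address_operations:
  assumes "i' < i" "j' < i' + 2" "j + 2 \<le> j'"
  shows "independent s n (address_sequence i' ! j') (address_sequence i ! j)"
proof -
  \<comment> \<open>The cut differs for addresses and data: \<open>Internal_Swap (j + 1)\<close>
    reads addresses of layer \<open>j\<close>, while \<open>Route Down (j - 1)\<close> moves data
    into layer \<open>j\<close> but reads addresses of layer \<open>j - 1\<close> only.\<close>
  define lower where "lower = {Data l p | l p. j < l} \<union> {Addr l p | l p. j \<le> l}"
  define upper where
    "upper = range Address_Bus \<union> {Data l p | l p. l \<le> j} \<union> {Addr l p | l p. l < j}"
  have "lower \<inter> upper = {}"
    by (auto simp: lower_def upper_def)
  moreover have "acts_within lower (gate_of s n x (address_sequence i' ! j'))" for x
  proof (cases "j' \<le> i'")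
    case True
    then have "address_sequence i' ! j' = Route Down (j' - 1)"
      using assms by (simp add: address_sequence_nth)
    then show ?thesis
      using assms by (auto intro!: acts_within_route simp: lower_def simp del: gate_of.simps)
  next
    case False
    then have "address_sequence i' ! j' = Internal_Swap i'"
      using assms by (simp add: address_sequence_nth)
    then show ?thesis
      using assms by (auto intro!: acts_within_internal_swap simp: lower_def simp del: gate_of.simps)
  qed
  moreover have "acts_within upper (gate_of s n x (address_sequence i ! j))" for x
  proof (cases "j = 0")
    case True
    then have "address_sequence i ! j = Address_Input i"
      by (simp add: address_sequence_nth)
    then show ?thesis
      by (auto intro!: acts_within_address_input simp: upper_def simp del: gate_of.simps)
  next
    case False
    \<comment> \<open>Not the internal swap, since \<open>j + 2 \<le> j'\<close> and
      \<open>j' < i' + 2\<close> give \<open>j < i'\<close>, hence \<open>j < i\<close>.\<close>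
    then have "address_sequence i ! j = Route Down (j - 1)"
      using assms by (simp add: address_sequence_nth)
    then show ?thesis
      using False by (auto intro!: acts_within_route simp: upper_def simp del: gate_of.simps)
  qed
  ultimately show ?thesis
    unfolding independent_def by blast
qed

text \<open>Across digits, a deadline that does not grow forces \<open>j + 2 \<le> j'\<close>;
  within a digit it grows with \<open>j\<close>. The tree size \<open>m\<close> is separate from the
  digit count \<open>n\<close>, so the induction leaves the gates fixed.\<close>

lemma sorted_wrt_address_deadlines:
  "sorted_wrt (\<lambda>(i', j') (i, j).
       independent s m (address_sequence i' ! j') (address_sequence i ! j) \<or>
       2 * i' + j' < 2 * i + j)
     (concat (map (\<lambda>i. map (Pair i) [0..<i + 2]) [0..<n]))"
proof (induction n)
  case 0
  then show ?case by simp
next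
  case (Suc n)
  have "independent s m (address_sequence i' ! j') (address_sequence n ! j) \<or>
      2 * i' + j' < 2 * n + j" if "i' < n" "j' < i' + 2" for i' j' j
    using independent_address_operations[of i' n j' j s m] that by linarith
  then show ?case
    using Suc
    by (fastforce simp: sorted_wrt_append sorted_wrt_map upt_Suc_append[of 0 n] simp del: upt_Suc
        intro: sorted_wrt_mono_rel[OF _ sorted_wrt_upt])
qed

lemma length_address_setting_le: "length (address_setting s n) \<le> 3 * n"
proof -
  define ps where "ps = concat (map (\<lambda>i. map (Pair i) [0..<i + 2]) [0..<n])"
  define f where "f = (\<lambda>(i, j). address_sequence i ! j)"
  define d :: "nat \<times> nat \<Rightarrow> nat" where "d = (\<lambda>(i, j). 2 * i + j)"
  have "map f (map (Pair i) [0..<i + 2]) = address_sequence i" for i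
    using map_nth[of "address_sequence i"] by (simp add: f_def comp_def)
  then have ops: "map f ps = concat (map address_sequence [0..<n])"
    by (simp add: ps_def map_concat comp_def del: upt_Suc)
  have "sorted_wrt (\<lambda>p q. independent s n (f p) (f q) \<or> d p < d q) ps"
    using sorted_wrt_address_deadlines[of s n n]
    by (simp add: ps_def f_def d_def case_prod_unfold)
  note E = as_early_as_possible_deadline[OF this, unfolded ops]
  show ?thesis
    unfolding address_setting_def
  proof (rule length_time_steps_le)
    fix t g
    assume "(t, g) \<in> as_early_as_possible s n (concat (map address_sequence [0..<n]))"
    then obtain p where "p \<in> set ps" "t \<le> d p"
      using E by blast
    \<comment> \<open>Here \<open>i \<le> n - 1\<close> and \<open>j \<le> i + 1\<close>, so
      \<open>t \<le> 3 * n - 2\<close>.\<close>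
    then show "t < 3 * n"
      by (auto simp: ps_def d_def)
  qed (use E in blast)
qed

lemma length_data_sequence [simp]: "length (data_sequence n i) = 2 * (n - 1) + 3"
  by (simp add: data_sequence_def)

lemma length_data_fetch_le:
  assumes "1 \<le> n"
  shows "length (data_fetch n k) \<le> 2 * n + 2 * k"
proof -
  define E where "E =
    {(2 * i + j, data_sequence n i ! j) | i j. i < k \<and> j < length (data_sequence n i)}"
  have "E = (\<lambda>(i, j). (2 * i + j, data_sequence n i ! j)) ` ({..<k} \<times> {..<2 * (n - 1) + 3})"
    by (auto simp: E_def)
  then have "finite E"
    by simp
  \<comment> \<open>For \<open>k \<ge> 1\<close> the last start is
    \<open>2 * (k - 1) + 2 * (n - 1) + 2\<close>; at \<open>n = 0\<close> the truncated
    \<open>n - 1\<close> would break the bound.\<close>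
  then have "length (time_steps E) \<le> 2 * n + 2 * k"
    by (rule length_time_steps_le) (use assms in \<open>auto simp: E_def\<close>)
  then show ?thesis
    by (simp add: data_fetch_def E_def)
qed

theorem proposition1:
  fixes s :: scheme
  shows "(\<lambda>(n, k). real (time_complexity s n k))
           \<in> O[principal {(n, k). 1 \<le> n \<and> 1 \<le> k}](\<lambda>(n, k). real (n + k))"
proof (rule bigoI[where c = 8])
  \<comment> \<open>The phases add up to \<open>3 * n + (2 * n + 2 * k) + 3 * n\<close>, whence the
    constant \<open>8\<close>.\<close>
  have "time_complexity s n k \<le> 8 * (n + k)" if "1 \<le> n" for n k
    using length_address_setting_le[of s n] length_data_fetch_le[OF that, of k]
    by (simp add: time_complexity_def parallel_protocol_def uncomputing_def)
  then have "real (time_complexity s n k) \<le> 8 * real (n + k)" if "1 \<le> n" for n k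
    using that by (metis of_nat_le_iff of_nat_mult of_nat_numeral)
  then show "\<forall>\<^sub>F p in principal {(n, k). 1 \<le> n \<and> 1 \<le> k}.
      norm (case p of (n, k) \<Rightarrow> real (time_complexity s n k))
      \<le> 8 * norm (case p of (n, k) \<Rightarrow> real (n + k))"
    by (auto simp: eventually_principal)
qed

end
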